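(* Let $H_2$ denote $\mathbb{R}^2$ or $\mathbb{C}^2$. Let $I=\{1,2,\ldots,k\}$ be some finite index set, and let $P\subseteq 2^I$ be a poset (a collection of subsets of $I$) ordered by set inclusion which contains no singletons. Then there exists some frame $F=\{f_i\}_{i\in I}\subseteq H_2\setminus\{0\}$ with factor poset $P$ if and only if $P$ is span-closed, i.e., $[J]\notin\mathcal{I}(P)$ for every $J\in 2^I\setminus P$.
   Context: A frame for $H_2$ is a finite sequence $\{f_i\}_{i\in I}$ (repetitions allowed) spanning $H_2$. It is tight if there is $\lambda>0$ with $\sum_{i\in I}|\langle x,f_i\rangle|^2=\lambda\|x\|^2$ for all $x\in H_2$. The factor poset of a frame $F=\{f_i\}_{i\in I}$ is $\mathbb{F}_F=\{J\subseteq I:\{f_j\}_{j\in J}\text{ is a tight frame for }H_2\}$, ordered by inclusion, with the convention $\emptyset\in\mathbb{F}_F$. For $J\subseteq I=\{1,\dots,k\}$, the index vector is $[J]=\sum_{j\in J}e_j\in\mathbb{R}^k$, where $e_1,\dots,e_k$ is the standard basis. For $P\subseteq 2^I$, the index span is $\mathcal{I}(P)=\operatorname{span}_{\mathbb{R}}\{[J]:J\in P\}$.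
   Formalization: The formal theorem assumes k ≥ 2; for k = 1 and P = {∅} the claim fails, since P is span-closed and contains no singletons, but a single vector cannot span H_2. *)

theory Defs
  imports "HOL-Analysis.Analysis"
begin

text \<open>
  The index set \<open>{1, \<dots>, k}\<close> is a finite type \<open>'n\<close> with \<open>k = CARD('n)\<close>, so subsets of the index
  set are values of type \<open>'n set\<close> and index vectors live in \<open>real ^ 'n\<close>. The plane \<open>H\<^sub>2\<close> is \<open>'a ^ 2\<close>
  with \<open>'a\<close> being \<open>real\<close> or \<open>complex\<close>; its inner product is passed as the parameter \<open>ip\<close>, and
  \<open>norm\<close> is the Euclidean norm in both cases.
\<close>

text \<open>On \<open>complex ^ 2\<close> the library's \<open>inner\<close> is only the real part of this form.\<close>

definition hermitian_inner :: "complex ^ 2 \<Rightarrow> complex ^ 2 \<Rightarrow> complex" where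
  "hermitian_inner x y = (\<Sum>i\<in>UNIV. x $ i * cnj (y $ i))"

text \<open>\<open>vec.span\<close> is the span over the scalar field \<open>'a\<close>, whereas \<open>span\<close> is always over the reals.\<close>

definition is_frame :: "'n::finite set \<Rightarrow> ('n \<Rightarrow> 'a::real_normed_field ^ 2) \<Rightarrow> bool" where
  "is_frame J f \<longleftrightarrow> vec.span (f ` J) = UNIV"

definition is_tight_frame ::
  "('a::real_normed_field ^ 2 \<Rightarrow> 'a ^ 2 \<Rightarrow> 'a) \<Rightarrow> 'n::finite set \<Rightarrow> ('n \<Rightarrow> 'a ^ 2) \<Rightarrow> bool" where
  "is_tight_frame ip J f \<longleftrightarrow>
     is_frame J f \<and>
     (\<exists>c::real. c > 0 \<and> (\<forall>x. (\<Sum>i\<in>J. (norm (ip x (f i)))\<^sup>2) = c * (norm x)\<^sup>2))"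

definition factor_poset ::
  "('a::real_normed_field ^ 2 \<Rightarrow> 'a ^ 2 \<Rightarrow> 'a) \<Rightarrow> ('n::finite \<Rightarrow> 'a ^ 2) \<Rightarrow> 'n set set" where
  "factor_poset ip f = {J. J = {} \<or> is_tight_frame ip J f}"

definition index_vector :: "'n::finite set \<Rightarrow> real ^ 'n" where
  "index_vector J = (\<Sum>j\<in>J. axis j 1)"

definition index_span :: "'n::finite set set \<Rightarrow> (real ^ 'n) set" where
  "index_span P = span (index_vector ` P)"

definition span_closed :: "'n::finite set set \<Rightarrow> bool" where
  "span_closed P \<longleftrightarrow> (\<forall>J. J \<notin> P \<longrightarrow> index_vector J \<notin> index_span P)"

end

theory Submission
  imports Defs
begin

text \<open>
  A set \<open>J\<close> of nonzero vectors is tight iff \<open>\<Sum>i\<in>J. (|\<langle>x, f\<^sub>i\<rangle>|\<^sup>2 - |f\<^sub>i|\<^sup>2 |x|\<^sup>2 / 2) = 0\<close> for every \<open>x\<close>,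
  and this condition is linear in the index vector of \<open>J\<close>; so factor posets are span-closed.
  Conversely, if \<open>P\<close> is span-closed, a generic vector \<open>y\<close> in the orthogonal complement of the index
  span is orthogonal to exactly those index vectors that come from \<open>P\<close>. Taking \<open>f\<^sub>i\<close> to be
  \<open>sqrt |y\<^sub>i|\<close> times the first or the second unit vector, according to the sign of \<open>y\<^sub>i\<close>, a set \<open>J\<close>
  is tight iff the total weight on both axes agrees, i.e. iff \<open>y\<close> sums to zero over \<open>J\<close>.
\<close>

section \<open>Generic orthogonal vectors\<close>

text \<open>Induction on \<open>W\<close>: the old \<open>y\<close> is shifted along the component
  of the new \<open>w\<close> orthogonal to \<open>span S\<close>; only finitely many shifts
  fail.\<close>

lemma exists_orthogonal_generic_vector:
  fixes S :: "'v::euclidean_space set"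
  assumes "finite W" and "W \<inter> span S = {}"
  shows "\<exists>y. (\<forall>v\<in>span S. y \<bullet> v = 0) \<and> (\<forall>w\<in>W. y \<bullet> w \<noteq> 0)"
  using assms
proof (induction W rule: finite_induct)
  case empty
  show ?case by (intro exI[of _ 0]) auto
next
  case (insert w W)
  then obtain y where y: "\<And>v. v \<in> span S \<Longrightarrow> y \<bullet> v = 0" "\<And>u. u \<in> W \<Longrightarrow> y \<bullet> u \<noteq> 0"
    by auto
  obtain v z where vz: "v \<in> span S" "\<And>u. u \<in> span S \<Longrightarrow> orthogonal z u" "w = v + z"
    using orthogonal_subspace_decomp_exists[of S w] by metis
  have "z \<noteq> 0"
    using vz insert.prems by auto
  moreover have "z \<bullet> w = z \<bullet> z"
    using vz by (auto simp: inner_add_right orthogonal_def)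
  ultimately have zw: "z \<bullet> w \<noteq> 0"
    by simp
  \<comment> \<open>The bad shifts. If \<open>z \<bullet> u = 0\<close>, division by zero merely
    excludes \<open>t = 0\<close> as well.\<close>
  define B where "B = (\<lambda>u. - (y \<bullet> u) / (z \<bullet> u)) ` insert w W"
  have "finite B"
    unfolding B_def using insert.hyps by simp
  then obtain t where t: "t \<notin> B"
    using ex_new_if_finite[OF infinite_UNIV_char_0] by blast
  have "(y + t *\<^sub>R z) \<bullet> u \<noteq> 0" if u: "u \<in> insert w W" for u
  proof
    assume eq: "(y + t *\<^sub>R z) \<bullet> u = 0"
    show False
    proof (cases "z \<bullet> u = 0")
      case True
      \<comment> \<open>Since \<open>z \<bullet> w \<noteq> 0\<close>, here \<open>u\<close> is in
        \<open>W\<close>, and the shift leaves \<open>y \<bullet> u \<noteq> 0\<close>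
        unchanged.\<close>
      then show False
        using eq u y(2) zw by (auto simp: inner_add_left)
    next
      case False
      then have "t = - (y \<bullet> u) / (z \<bullet> u)"
        using eq by (simp add: inner_add_left field_simps add_eq_0_iff)
      then show False
        using t u unfolding B_def by blast
    qed
  qed
  moreover have "(y + t *\<^sub>R z) \<bullet> u = 0" if "u \<in> span S" for u
    using y(1)[OF that] vz(2)[OF that] by (simp add: inner_add_left orthogonal_def)
  ultimately show ?case
    by blast
qed

section \<open>Index vectors and weights\<close>

lemma inner_index_vector: "y \<bullet> index_vector J = (\<Sum>i\<in>J. y $ i)"
  by (simp add: index_vector_def inner_sum_right inner_axis)

lemma sum_eq_0_if_index_vector_in_span:
  fixes y :: "'n::finite \<Rightarrow> real"
  assumes "\<And>K. K \<in> P \<Longrightarrow> sum y K = 0" and "index_vector J \<in> index_span P"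
  shows "sum y J = 0"
proof -
  have *: "(\<chi> i. y i) \<bullet> index_vector K = sum y K" for K
    by (simp add: inner_index_vector)
  have "orthogonal (\<chi> i. y i) (index_vector J)"
    using assms(1)
    by (intro orthogonal_to_span[OF assms(2)[unfolded index_span_def]]) (auto simp: orthogonal_def *)
  then show ?thesis
    by (simp add: orthogonal_def *)
qed

text \<open>Both signs are needed for the frame to span the plane. A nonempty member of
  \<open>P\<close> forces them, as nonzero weights sum to zero over it; otherwise explicit weights
  are chosen.\<close>

lemma span_closed_sign_weights:
  fixes P :: "'n::finite set set"
  assumes card: "CARD('n) \<ge> 2" and single: "\<And>i. {i} \<notin> P" and closed: "span_closed P"
  obtains y :: "'n \<Rightarrow> real"
  where "\<And>J. J \<in> P \<longleftrightarrow> sum y J = 0" and "\<exists>i. y i > 0" and "\<exists>i. y i < 0"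
proof (cases "P = {{}}")
  case True
  obtain a b :: 'n where ab: "a \<noteq> b"
    using card card_le_Suc0_iff_eq[of "UNIV :: 'n set"] by force
  \<comment> \<open>Parity: the sum is odd on sets containing \<open>a\<close>, and twice the
    cardinality on all others.\<close>
  define y :: "'n \<Rightarrow> real" where "y = (\<lambda>i. if i = a then -1 else 2)"
  have "sum y J = 0 \<longleftrightarrow> J = {}" for J
  proof
    assume eq: "sum y J = 0"
    have rest: "sum y (J - {a}) = of_int (2 * int (card (J - {a})))"
      by (simp add: y_def)
    have "a \<notin> J"
    proof
      assume "a \<in> J"
      then have "sum y J = -1 + sum y (J - {a})"
        by (simp add: sum.remove[of J a] y_def)
      then have "2 * int (card (J - {a})) = 1"
        using eq rest by linarith
      then show False
        by presburger
    qed
    then show "J = {}"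
      using eq rest by simp
  qed simp
  moreover have "y a < 0" "y b > 0"
    using ab by (auto simp: y_def)
  ultimately show thesis
    using that[of y] True by auto
next
  case False
  \<comment> \<open>Its index vector is 0, which lies in every span.\<close>
  have "{} \<in> P"
    using closed unfolding span_closed_def index_span_def
    by (force simp: index_vector_def span_zero)
  with False obtain K where K: "K \<in> P" "K \<noteq> {}"
    by auto
  have "index_vector ` (- P) \<inter> span (index_vector ` P) = {}"
    using closed unfolding span_closed_def index_span_def by auto
  then obtain z :: "real ^ 'n" where
    z: "\<And>v. v \<in> span (index_vector ` P) \<Longrightarrow> z \<bullet> v = 0"
       "\<And>J. J \<notin> P \<Longrightarrow> z \<bullet> index_vector J \<noteq> 0"
    using exists_orthogonal_generic_vector[of "index_vector ` (- P)" "index_vector ` P"] by auto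
  have iff: "J \<in> P \<longleftrightarrow> sum (($) z) J = 0" for J
    using z(1)[of "index_vector J"] z(2)[of J] by (auto simp: inner_index_vector span_base)
  have nz: "z $ i \<noteq> 0" for i
    using iff[of "{i}"] single by simp
  have sumK: "sum (($) z) K = 0"
    using K iff by blast
  have "\<exists>i. z $ i > 0"
  proof (rule ccontr)
    assume "\<not> ?thesis"
    then have "z $ i < 0" for i
      using nz by (meson linorder_neqE)
    then have "sum (($) z) K < sum (\<lambda>_. 0) K"
      using K by (intro sum_strict_mono) auto
    then show False
      using sumK by simp
  qed
  moreover have "\<exists>i. z $ i < 0"
  proof (rule ccontr)
    assume "\<not> ?thesis"
    then have "z $ i > 0" for i
      using nz by (meson linorder_neqE)
    then have "sum (\<lambda>_. 0) K < sum (($) z) K"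
      using K by (intro sum_strict_mono) auto
    then show False
      using sumK by simp
  qed
  ultimately show thesis
    using that[of "($) z"] iff by blast
qed

section \<open>Tight frames in the plane\<close>

lemma norm_squared_vec2: "(norm x)\<^sup>2 = (norm (x $ 1))\<^sup>2 + (norm (x $ 2))\<^sup>2"
  for x :: "'a::real_normed_field ^ 2"
  by (simp add: norm_vec_def L2_set_def sum_2)

text \<open>Cramer's rule gives the coefficients of any vector in terms of \<open>u\<close> and
  \<open>v\<close>.\<close>

lemma vec_span_eq_UNIV_2:
  fixes u v :: "'a::field ^ 2"
  assumes "u \<in> S" "v \<in> S" and det: "u $ 1 * v $ 2 \<noteq> u $ 2 * v $ 1"
  shows "vec.span S = UNIV"
proof -
  define d where "d = u $ 1 * v $ 2 - u $ 2 * v $ 1"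
  have d: "d \<noteq> 0"
    using det by (simp add: d_def)
  have "x \<in> vec.span S" for x
  proof -
    let ?a = "(x $ 1 * v $ 2 - x $ 2 * v $ 1) / d" and ?b = "(u $ 1 * x $ 2 - u $ 2 * x $ 1) / d"
    have "d * x $ 1 = (x $ 1 * v $ 2 - x $ 2 * v $ 1) * u $ 1 + (u $ 1 * x $ 2 - u $ 2 * x $ 1) * v $ 1"
      and "d * x $ 2 = (x $ 1 * v $ 2 - x $ 2 * v $ 1) * u $ 2 + (u $ 1 * x $ 2 - u $ 2 * x $ 1) * v $ 2"
      by (simp_all add: d_def algebra_simps)
    then have "x = ?a *s u + ?b *s v"
      using d by (simp add: vec_eq_iff forall_2 eq_divide_eq mult.commute flip: add_divide_distrib)
    moreover have "?a *s u + ?b *s v \<in> vec.span S"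
      using assms by (intro vec.span_add vec.span_scale vec.span_base)
    ultimately show ?thesis
      by simp
  qed
  then show ?thesis
    by auto
qed

text \<open>Treats the real (\<open>cj = id\<close>) and the complex (\<open>cj = cnj\<close>) plane at once.\<close>

locale sesquilinear_plane =
  fixes cj :: "'a::real_normed_field \<Rightarrow> 'a"
    and ip :: "'a ^ 2 \<Rightarrow> 'a ^ 2 \<Rightarrow> 'a"
  assumes cj_mult: "cj (z * w) = cj z * cj w"
    and norm_cj [simp]: "norm (cj z) = norm z"
    and ip_eq: "ip x y = x $ 1 * cj (y $ 1) + x $ 2 * cj (y $ 2)"
begin

text \<open>The traceless part of the quadratic form \<open>(norm (ip x g))\<^sup>2\<close> in
  \<open>x\<close>, whose trace is \<open>(norm g)\<^sup>2\<close>.\<close>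

definition defect :: "'a ^ 2 \<Rightarrow> 'a ^ 2 \<Rightarrow> real" where
  "defect x g = (norm (ip x g))\<^sup>2 - (norm g)\<^sup>2 / 2 * (norm x)\<^sup>2"

lemma cj_0 [simp]: "cj 0 = 0"
  using norm_cj[of 0] by (simp del: norm_cj)

lemma is_frame_if_tight_bound:
  fixes f :: "'n::finite \<Rightarrow> 'a ^ 2"
  assumes "J \<noteq> {}" and nz: "\<And>i. f i \<noteq> 0" and "c > 0"
    and tight: "\<And>x. (\<Sum>i\<in>J. (norm (ip x (f i)))\<^sup>2) = c * (norm x)\<^sup>2"
  shows "is_frame J f"
proof (rule ccontr)
  assume nf: "\<not> is_frame J f"
  obtain j where j: "j \<in> J"
    using assms by auto
  define v where "v = f j"
  \<comment> \<open>Orthogonal to \<open>v\<close>, hence to every \<open>f i\<close> with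
    \<open>i\<close> in \<open>J\<close>, since without spanning these are all parallel to
    \<open>v\<close>.\<close>
  define x :: "'a ^ 2" where "x = vector [cj (v $ 2), - cj (v $ 1)]"
  have "v \<noteq> 0"
    using nz by (simp add: v_def)
  have norm_x: "(norm x)\<^sup>2 = (norm v)\<^sup>2"
    by (simp add: x_def norm_squared_vec2)
  have "ip x (f i) = 0" if "i \<in> J" for i
  proof -
    have "v $ 1 * f i $ 2 = v $ 2 * f i $ 1"
      using nf vec_span_eq_UNIV_2[of v "f ` J" "f i"] j that by (auto simp: is_frame_def v_def)
    then show ?thesis
      by (simp add: ip_eq x_def flip: cj_mult)
  qed
  then have "c * (norm x)\<^sup>2 = 0"
    using tight[of x] by simp
  then show False
    using \<open>c > 0\<close> \<open>v \<noteq> 0\<close> norm_x by simp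
qed

text \<open>The frame constant is forced to be half the trace \<open>\<Sum>i\<in>J. (norm (f i))\<^sup>2\<close>.\<close>

lemma factor_poset_iff_defect:
  fixes f :: "'n::finite \<Rightarrow> 'a ^ 2"
  assumes nz: "\<And>i. f i \<noteq> 0"
  shows "J \<in> factor_poset ip f \<longleftrightarrow> (\<forall>x. (\<Sum>i\<in>J. defect x (f i)) = 0)"
proof -
  have defect: "(\<Sum>i\<in>J. defect x (f i)) =
      (\<Sum>i\<in>J. (norm (ip x (f i)))\<^sup>2) - (\<Sum>i\<in>J. (norm (f i))\<^sup>2) / 2 * (norm x)\<^sup>2" for x
    by (simp add: defect_def sum_subtractf sum_distrib_right sum_divide_distrib)
  show ?thesis
  proof (cases "J = {}")
    case True
    then show ?thesis
      by (simp add: factor_poset_def)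
  next
    case False
    show ?thesis
    proof
      assume "J \<in> factor_poset ip f"
      then obtain c where c: "\<And>x. (\<Sum>i\<in>J. (norm (ip x (f i)))\<^sup>2) = c * (norm x)\<^sup>2"
        using False by (auto simp: factor_poset_def is_tight_frame_def)
      have "(\<Sum>i\<in>J. (norm (f i $ 1))\<^sup>2) = c" "(\<Sum>i\<in>J. (norm (f i $ 2))\<^sup>2) = c"
        using c[of "axis 1 1"] c[of "axis 2 1"]
        by (simp_all add: ip_eq norm_squared_vec2 axis_def)
      then have "(\<Sum>i\<in>J. (norm (f i))\<^sup>2) = 2 * c"
        by (simp add: norm_squared_vec2 sum.distrib)
      then show "\<forall>x. (\<Sum>i\<in>J. defect x (f i)) = 0"
        by (simp add: defect c)
    next
      assume zero: "\<forall>x. (\<Sum>i\<in>J. defect x (f i)) = 0"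
      define c where "c = (\<Sum>i\<in>J. (norm (f i))\<^sup>2) / 2"
      have "c > 0"
        unfolding c_def using False nz by (intro divide_pos_pos sum_pos) auto
      moreover have tight: "(\<Sum>i\<in>J. (norm (ip x (f i)))\<^sup>2) = c * (norm x)\<^sup>2" for x
        using zero defect[of x] by (simp add: c_def)
      ultimately show "J \<in> factor_poset ip f"
        using is_frame_if_tight_bound[OF False nz _ tight]
        by (auto simp: factor_poset_def is_tight_frame_def)
    qed
  qed
qed

text \<open>For each fixed \<open>x\<close> the defects are weights summing to zero over every
  member of the poset, hence over every set whose index vector lies in the index span.\<close>

lemma span_closed_factor_poset:
  fixes f :: "'n::finite \<Rightarrow> 'a ^ 2"
  assumes nz: "\<And>i. f i \<noteq> 0"
  shows "span_closed (factor_poset ip f)"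
  unfolding span_closed_def
proof (intro allI impI notI)
  fix J
  assume "J \<notin> factor_poset ip f" and span: "index_vector J \<in> index_span (factor_poset ip f)"
  moreover have "(\<Sum>i\<in>J. defect x (f i)) = 0" for x
    by (rule sum_eq_0_if_index_vector_in_span[OF _ span]) (simp add: factor_poset_iff_defect nz)
  ultimately show False
    using factor_poset_iff_defect[of f, OF nz] by blast
qed

lemma exists_frame_with_factor_poset:
  fixes P :: "'n::finite set set" and y :: "'n \<Rightarrow> real"
  assumes P: "\<And>J. J \<in> P \<longleftrightarrow> sum y J = 0" and nz: "\<And>i. y i \<noteq> 0"
    and pos: "\<exists>i. y i > 0" and neg: "\<exists>i. y i < 0"
  shows "\<exists>f :: 'n \<Rightarrow> 'a ^ 2. (\<forall>i. f i \<noteq> 0) \<and> is_frame UNIV f \<and> factor_poset ip f = P"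
proof -
  define f :: "'n \<Rightarrow> 'a ^ 2"
    where "f i = axis (if y i > 0 then 1 else 2) (of_real (sqrt \<bar>y i\<bar>))" for i
  have f_nz: "f i \<noteq> 0" for i
    using nz[of i] by (simp add: f_def)
  obtain p n where "y p > 0" "y n < 0"
    using pos neg by auto
  then have "f p $ 1 * f n $ 2 \<noteq> f p $ 2 * f n $ 1"
    by (simp add: f_def axis_def)
  then have frame: "is_frame UNIV f"
    unfolding is_frame_def by (rule vec_span_eq_UNIV_2[rotated 2]) auto
  \<comment> \<open>Swapping the axes negates the form on the right, so the choice of axis restores
    the sign lost in \<open>\<bar>y i\<bar>\<close>.\<close>
  have "defect x (f i) = y i * (((norm (x $ 1))\<^sup>2 - (norm (x $ 2))\<^sup>2) / 2)" for x i
    by (cases "y i > 0")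
      (simp_all add: defect_def f_def axis_def ip_eq norm_squared_vec2 norm_mult
        algebra_simps)
  then have sum_defect:
    "(\<Sum>i\<in>J. defect x (f i)) = sum y J * (((norm (x $ 1))\<^sup>2 - (norm (x $ 2))\<^sup>2) / 2)" for x J
    by (simp only: sum_distrib_right)
  have "J \<in> factor_poset ip f \<longleftrightarrow> J \<in> P" for J
  proof -
    have "sum y J = 0" if "\<forall>x. (\<Sum>i\<in>J. defect x (f i)) = 0"
      \<comment> \<open>At this vector the common form equals 1/2.\<close>
      using that[THEN spec, of "axis 1 1"] by (simp add: sum_defect axis_def)
    then show ?thesis
      by (auto simp: factor_poset_iff_defect f_nz P sum_defect)
  qed
  then show ?thesis
    using f_nz frame by blast
qed

theorem exists_frame_iff_span_closed:
  fixes P :: "'n::finite set set"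
  assumes "CARD('n) \<ge> 2" and single: "\<And>i. {i} \<notin> P"
  shows "(\<exists>f :: 'n \<Rightarrow> 'a ^ 2. (\<forall>i. f i \<noteq> 0) \<and> is_frame UNIV f \<and> factor_poset ip f = P)
    \<longleftrightarrow> span_closed P"
proof
  assume "span_closed P"
  then obtain y :: "'n \<Rightarrow> real" where
    y: "\<And>J. J \<in> P \<longleftrightarrow> sum y J = 0" "\<exists>i. y i > 0" "\<exists>i. y i < 0"
    using span_closed_sign_weights[OF assms] by blast
  have "y i \<noteq> 0" for i
    using y(1)[of "{i}"] single by simp
  then show "\<exists>f :: 'n \<Rightarrow> 'a ^ 2. (\<forall>i. f i \<noteq> 0) \<and> is_frame UNIV f \<and> factor_poset ip f = P"
    using exists_frame_with_factor_poset y by blast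
qed (use span_closed_factor_poset in blast)

end

interpretation real_plane: sesquilinear_plane id "inner :: real ^ 2 \<Rightarrow> real ^ 2 \<Rightarrow> real"
  by standard (simp_all add: inner_vec_def sum_2)

interpretation complex_plane: sesquilinear_plane cnj hermitian_inner
  by standard (simp_all add: hermitian_inner_def sum_2)

theorem theorem7:
  fixes P :: "'n::finite set set"
  assumes "CARD('n) \<ge> 2"
    and "\<forall>i. {i} \<notin> P"
  shows "((\<exists>f :: 'n \<Rightarrow> real ^ 2.
             (\<forall>i. f i \<noteq> 0) \<and> is_frame UNIV f \<and> factor_poset inner f = P)
           \<longleftrightarrow> span_closed P)
       \<and> ((\<exists>f :: 'n \<Rightarrow> complex ^ 2.
             (\<forall>i. f i \<noteq> 0) \<and> is_frame UNIV f \<and> factor_poset hermitian_inner f = P)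
           \<longleftrightarrow> span_closed P)"
  using real_plane.exists_frame_iff_span_closed[of P]
    complex_plane.exists_frame_iff_span_closed[of P] assms
  by blast

end
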